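(* For all non-zero complex-valued $f\in C_{0}^{\infty}(\mathbb{R}^{n})$, $$\left(\int_{\mathbb{R}^{n}}|\nabla f|^{2}\,dz\right)\left(\int_{\mathbb{R}^{n}}|z|^{2}|f|^{2}\,dz\right)-\frac{n^2}{4}\left(\int_{\mathbb{R}^{n}}|f|^{2}\,dz\right)^{2}=\left(\int_{\mathbb{R}^{n}}|z|^{2}|f|^{2}\,dz\right)\int_{\mathbb{R}^{n}}C_{2}\left(\nabla f,e^{-\alpha_{2,n}|z|^{2}}\nabla\left(\frac{f}{e^{-\alpha_{2,n}|z|^{2}}}\right)\right)dz$$ $$=\left(\int_{\mathbb{R}^{n}}|z|^{2}|f|^{2}\,dz\right)\int_{\mathbb{R}^{n}}\left|e^{-\alpha_{2,n}|z|^{2}}\nabla\left(\frac{f}{e^{-\alpha_{2,n}|z|^{2}}}\right)\right|^{2}dz,$$ where $$\alpha_{2,n}=\frac{n}{4}\,\frac{\int_{\mathbb{R}^{n}}|f|^{2}\,dz}{\int_{\mathbb{R}^{n}}|z|^{2}|f|^{2}\,dz}.$$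
   Context: $\nabla$ is the Euclidean gradient on $\mathbb{R}^n$, $|\cdot|$ the Euclidean norm, $dz$ Lebesgue measure, and $C_0^\infty(\mathbb{R}^n)$ the space of smooth compactly supported functions. For $\xi,\eta\in\mathbb{C}^{n}$, $$C_2(\xi,\eta):=|\xi|^2-|\xi-\eta|^2-2\,\mathrm{Re}\big((\xi-\eta)\cdot\overline{\eta}\big).$$ *)

theory Defs
  imports "HOL-Analysis.Analysis"
begin

text \<open>
  The dimension is the cardinality of the finite index type \<open>'n\<close>. The gradient of a
  complex-valued function is the \<open>\<complex>\<^sup>n\<close>-valued field of its partial derivatives; the norm of
  \<open>complex ^ 'n\<close> is the Euclidean one.
\<close>

definition gradient :: "(real ^ 'n \<Rightarrow> complex) \<Rightarrow> real ^ 'n \<Rightarrow> complex ^ 'n" where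
  "gradient f z = (\<chi> i. frechet_derivative f (at z) (axis i 1))"

primrec C_k :: "nat \<Rightarrow> (real ^ 'n \<Rightarrow> complex) \<Rightarrow> bool" where
  "C_k 0 f \<longleftrightarrow> continuous_on UNIV f"
| "C_k (Suc k) f \<longleftrightarrow> f differentiable_on UNIV \<and> (\<forall>i. C_k k (\<lambda>z. gradient f z $ i))"

definition C0_infinity :: "(real ^ 'n \<Rightarrow> complex) set" where
  "C0_infinity = {f. (\<forall>k. C_k k f) \<and> compact (closure (support_on UNIV f))}"

text \<open>
  The dot in \<open>C\<^sub>2\<close> is the bilinear product on \<open>\<complex>\<^sup>n\<close>, so the conjugate is written explicitly.
\<close>

definition C2 :: "complex ^ 'n \<Rightarrow> complex ^ 'n \<Rightarrow> real" where
  "C2 \<xi> \<eta> = (norm \<xi>)\<^sup>2 - (norm (\<xi> - \<eta>))\<^sup>2 - 2 * Re (\<Sum>i\<in>UNIV. (\<xi> - \<eta>) $ i * cnj (\<eta> $ i))"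

definition alpha2 :: "(real ^ 'n \<Rightarrow> complex) \<Rightarrow> real" where
  "alpha2 f = real CARD('n) / 4 *
     ((LINT z|lborel. (cmod (f z))\<^sup>2) / (LINT z|lborel. (norm z)\<^sup>2 * (cmod (f z))\<^sup>2))"

definition gaussian :: "real \<Rightarrow> real ^ 'n \<Rightarrow> real" where
  "gaussian \<alpha> z = exp (- \<alpha> * (norm z)\<^sup>2)"

definition weighted_gradient :: "real \<Rightarrow> (real ^ 'n \<Rightarrow> complex) \<Rightarrow> real ^ 'n \<Rightarrow> complex ^ 'n" where
  "weighted_gradient \<alpha> f z =
     gaussian \<alpha> z *\<^sub>R gradient (\<lambda>w. f w / complex_of_real (gaussian \<alpha> w)) z"

end

theory Submission
  imports Defs
begin

text \<open>
  The algebraic identity \<open>C2 \<xi> \<eta> = |\<eta>|\<^sup>2\<close> reduces both equalities to one.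
  The product rule gives \<open>weighted_gradient a f z = \<nabla>f(z) + 2a f(z) z\<close>, because the gradient of
  \<open>1 / gaussian\<close> is \<open>2a z / gaussian\<close>. Expanding the square, with \<open>A = \<integral>|f|\<^sup>2\<close> and
  \<open>B = \<integral>|z|\<^sup>2|f|\<^sup>2\<close>, leaves
    \<open>\<integral>|\<nabla>f|\<^sup>2 + 4a \<integral> Re (cnj f (z \<cdot> \<nabla>f)) + 4a\<^sup>2 B\<close>.
  The cross term contains \<open>z \<cdot> \<nabla>|f|\<^sup>2 = 2 Re (cnj f (z \<cdot> \<nabla>f))\<close>, whose integral is \<open>-n A\<close>, so the
  whole is \<open>\<integral>|\<nabla>f|\<^sup>2 - 2anA + 4a\<^sup>2 B\<close> (lemma \<open>integral_weighted_gradient\<close>). The value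
  \<open>a = nA / (4B)\<close> is the minimiser of this quadratic in \<open>a\<close>, and multiplying the minimum by \<open>B\<close>
  gives the claim; \<open>B\<close> is positive since \<open>f\<close> is continuous and not identically zero.

  The one analytic fact is \<open>\<integral> z \<cdot> \<nabla>h = -n \<integral> h\<close> (lemma \<open>integral_radial_derivative\<close>). Instead of
  integrating by parts one coordinate at a time, the proof differentiates the scaling law
  \<open>\<integral> h(tz) dz = t\<^sup>-\<^sup>n \<integral> h\<close> at \<open>t = 1\<close>: the left-hand side has derivative \<open>\<integral> z \<cdot> \<nabla>h\<close>, by dominated
  convergence, and the right-hand side has derivative \<open>-n \<integral> h\<close>.
\<close>

section \<open>Functions vanishing outside a ball\<close>

lemma integrable_continuous_vanishing_outside_ball:
  fixes h :: "'a::euclidean_space \<Rightarrow> real"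
  assumes cont: "continuous_on UNIV h" and out: "\<And>z. norm z > R \<Longrightarrow> h z = 0"
  shows "integrable lborel h"
proof -
  have "integrable lborel (\<lambda>z. indicator (cball 0 R) z *\<^sub>R h z)"
    using borel_integrable_compact[of "cball 0 R" h] continuous_on_subset[OF cont]
    by (auto simp: set_integrable_def)
  also have "(\<lambda>z. indicator (cball 0 R) z *\<^sub>R h z) = h"
    using out by (auto simp: fun_eq_iff indicator_def not_le)
  finally show ?thesis .
qed

lemma derivative_vanishes_outside_ball:
  fixes h :: "'a::real_normed_vector \<Rightarrow> 'b::real_normed_vector"
  assumes D: "(h has_derivative D) (at z)"
    and out: "\<And>z. norm z > R \<Longrightarrow> h z = 0" and z: "norm z > R"
  shows "D = (\<lambda>_. 0)"
proof -
  have "((\<lambda>_. 0) has_derivative D) (at z)"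
    by (rule has_derivative_transform_within_open[OF D, of "{w. norm w > R}"])
       (use out z in \<open>auto intro!: open_Collect_less continuous_intros\<close>)
  then show ?thesis
    by (rule has_derivative_unique) simp
qed

section \<open>The integral of the radial derivative\<close>

lemma integral_dilation:
  fixes h :: "'a::euclidean_space \<Rightarrow> real"
  assumes [measurable]: "h \<in> borel_measurable borel" and "c > 0"
  shows "(LINT z|lborel. h (c *\<^sub>R z)) = (LINT z|lborel. h z) / c ^ DIM('a)"
proof -
  have "(LINT z|lborel. h z)
      = (LINT z|density (distr lborel borel (\<lambda>z. 0 + c *\<^sub>R z)) (\<lambda>_. ennreal (\<bar>c\<bar> ^ DIM('a))). h z)"
    using lborel_affine[of c "0::'a"] \<open>c > 0\<close> by (simp add: ennreal_power)
  also have "\<dots> = c ^ DIM('a) * (LINT z|lborel. h (c *\<^sub>R z))"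
    using \<open>c > 0\<close> by (subst integral_density) (auto simp: integral_distr)
  finally show ?thesis
    using \<open>c > 0\<close> by simp
qed

lemma dilation_has_derivative:
  fixes h :: "'a::real_normed_vector \<Rightarrow> real"
  assumes D: "(h has_derivative D) (at (t *\<^sub>R z))"
  shows "((\<lambda>t. h (t *\<^sub>R z)) has_real_derivative D z) (at t)"
proof -
  interpret bounded_linear D using D by (rule has_derivative_bounded_linear)
  have "((\<lambda>t. h (t *\<^sub>R z)) has_derivative (\<lambda>s. D (s *\<^sub>R z))) (at t)"
    by (rule has_derivative_compose[of "\<lambda>t. t *\<^sub>R z", OF _ D]) (auto intro!: derivative_eq_intros)
  then show ?thesis
    by (simp add: has_field_derivative_def scaleR mult_commute_abs)
qed

lemma dilation_quotient_tendsto: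
  assumes "(\<phi> has_real_derivative d) (at 1)"
  shows "(\<lambda>k. (\<phi> (1 + inverse (real (Suc k))) - \<phi> 1) * real (Suc k)) \<longlonglongrightarrow> d"
proof -
  have "filterlim (\<lambda>k. inverse (real (Suc k))) (at 0) sequentially"
    by (intro filterlim_atI LIMSEQ_inverse_real_of_nat) auto
  with assms have "(\<lambda>k. (\<phi> (1 + inverse (real (Suc k))) - \<phi> 1) / inverse (real (Suc k))) \<longlonglongrightarrow> d"
    unfolding DERIV_def by (rule filterlim_compose)
  then show ?thesis by (simp add: field_simps)
qed

text \<open>
  The integral of \<open>h (s z)\<close> is \<open>s\<^sup>-\<^sup>n\<close> times that of \<open>h\<close>, and both sides are compared to first order
  as \<open>s\<close> decreases to \<open>1\<close>. Taking \<open>s > 1\<close> means that dilation only shrinks the support, so that the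
  difference quotients all vanish outside the original ball. Their bound comes from the mean value
  theorem along the ray through \<open>z\<close>, where the derivative of \<open>t \<mapsto> h (t z)\<close> is
  \<open>D (t z) z = D (t z) (t z) / t\<close>; hence a bound on the radial derivative alone suffices.
\<close>

lemma integral_radial_derivative:
  fixes h :: "'a::euclidean_space \<Rightarrow> real"
  assumes D: "\<And>z. (h has_derivative D z) (at z)"
    and cont: "continuous_on UNIV (\<lambda>z. D z z)"
    and out: "\<And>z. norm z > R \<Longrightarrow> h z = 0"
  shows "(LINT z|lborel. D z z) = - real DIM('a) * (LINT z|lborel. h z)"
proof -
  define s where "s k = 1 + inverse (real (Suc k))" for k
  define q where "q k z = (h (s k *\<^sub>R z) - h z) * real (Suc k)" for k z
  have s: "s k > 1" for k by (simp add: s_def)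
  have h_cont: "continuous_on UNIV h"
    using D by (meson continuous_at_imp_continuous_on has_derivative_continuous)
  have [measurable]: "h \<in> borel_measurable borel" "(\<lambda>z. D z z) \<in> borel_measurable borel"
    using h_cont cont by (auto intro: borel_measurable_continuous_onI)
  have D_out: "D z z = 0" if "norm z > R" for z
    using derivative_vanishes_outside_ball[OF D out that] by simp
  have int_h: "integrable lborel h"
    using h_cont out by (rule integrable_continuous_vanishing_outside_ball)
  obtain C where C: "\<And>z. \<bar>D z z\<bar> \<le> C"
  proof -
    have "bounded ((\<lambda>z. D z z) ` cball 0 R)"
      by (intro compact_imp_bounded compact_continuous_image continuous_on_subset[OF cont]) auto
    then obtain C where "\<And>z. z \<in> cball 0 R \<Longrightarrow> \<bar>D z z\<bar> \<le> C" "C > 0"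
      unfolding bounded_pos by (metis imageI real_norm_def)
    then have "\<bar>D z z\<bar> \<le> C" for z
      using D_out[of z] by (cases "norm z > R") (auto simp: less_imp_le)
    then show thesis by (rule that)
  qed
  have q_bound: "\<bar>q k z\<bar> \<le> C * indicator (cball 0 R) z" for k z
  proof (cases "norm z > R")
    case True
    then have "norm (s k *\<^sub>R z) > R"
      using s[of k] mult_right_mono[of 1 "s k" "norm z"] by auto
    with True show ?thesis by (simp add: q_def out)
  next
    case False
    obtain t where t: "1 < t" "t < s k" "h (s k *\<^sub>R z) - h (1 *\<^sub>R z) = (s k - 1) * D (t *\<^sub>R z) z"
      using MVT2[OF s, of k "\<lambda>t. h (t *\<^sub>R z)" "\<lambda>t. D (t *\<^sub>R z) z"] dilation_has_derivative[OF D] by blast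
    \<comment> \<open>The radial bound applies to the direction \<open>t z\<close>, and passing to it only increases the value, as \<open>t > 1\<close>.\<close>
    interpret bounded_linear "D (t *\<^sub>R z)" using D by (rule has_derivative_bounded_linear)
    have "q k z = D (t *\<^sub>R z) z"
      using t(3) by (simp add: q_def s_def)
    moreover have "\<bar>D (t *\<^sub>R z) z\<bar> \<le> t * \<bar>D (t *\<^sub>R z) z\<bar>"
      using t(1) by (simp add: mult_le_cancel_right1)
    moreover have "t * \<bar>D (t *\<^sub>R z) z\<bar> = \<bar>D (t *\<^sub>R z) (t *\<^sub>R z)\<bar>"
      using t(1) by (simp add: scaleR abs_mult)
    ultimately show ?thesis
      using C[of "t *\<^sub>R z"] False by (simp add: indicator_def not_less)
  qed
  have "(\<lambda>k. LINT z|lborel. q k z) \<longlonglongrightarrow> (LINT z|lborel. D z z)"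
  proof (rule integral_dominated_convergence[where w = "\<lambda>z. C * indicator (cball 0 R) z"])
    show "integrable lborel (\<lambda>z::'a. C * indicator (cball 0 R) z)"
      by (intro integrable_mult_right integrable_real_indicator)
         (auto simp: emeasure_bounded_finite[unfolded infinity_ennreal_def])
    show "AE z in lborel. (\<lambda>k. q k z) \<longlonglongrightarrow> D z z"
      using dilation_quotient_tendsto[OF dilation_has_derivative[of h _ 1]] D
      by (auto simp: q_def s_def)
    show "AE z in lborel. norm (q k z) \<le> C * indicator (cball 0 R) z" for k
      using q_bound by simp
  qed (simp_all add: q_def[abs_def])
  moreover have "(LINT z|lborel. q k z)
      = (inverse (s k ^ DIM('a)) - 1) * real (Suc k) * (LINT z|lborel. h z)" for k
  proof -
    have "integrable lborel (\<lambda>z. h (s k *\<^sub>R z))"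
    proof (rule integrable_continuous_vanishing_outside_ball[where R = R])
      show "continuous_on UNIV (\<lambda>z. h (s k *\<^sub>R z))"
        by (rule continuous_on_compose2[OF h_cont]) (auto intro!: continuous_intros)
      show "h (s k *\<^sub>R z) = 0" if "norm z > R" for z
        using s[of k] mult_right_mono[of 1 "s k" "norm z"] that by (intro out) auto
    qed
    then have "(LINT z|lborel. q k z)
        = ((LINT z|lborel. h (s k *\<^sub>R z)) - (LINT z|lborel. h z)) * real (Suc k)"
      unfolding q_def using int_h by simp
    also have "(LINT z|lborel. h (s k *\<^sub>R z)) = (LINT z|lborel. h z) / s k ^ DIM('a)"
      using s[of k] by (intro integral_dilation) auto
    finally show ?thesis by (simp add: divide_inverse algebra_simps)
  qed
  moreover have "(\<lambda>k. (inverse (s k ^ DIM('a)) - 1) * real (Suc k)) \<longlonglongrightarrow> - real DIM('a)"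
  proof -
    have "((\<lambda>t. inverse (t ^ DIM('a))) has_real_derivative - real DIM('a)) (at 1)"
      by (auto intro!: derivative_eq_intros)
    from dilation_quotient_tendsto[OF this] show ?thesis by (simp add: s_def)
  qed
  then have "(\<lambda>k. (inverse (s k ^ DIM('a)) - 1) * real (Suc k) * (LINT z|lborel. h z))
      \<longlonglongrightarrow> - real DIM('a) * (LINT z|lborel. h z)"
    by (rule tendsto_mult_right)
  ultimately show ?thesis
    using LIMSEQ_unique by simp
qed

section \<open>The weighted gradient\<close>

text \<open>
  \<open>C2\<close> is the remainder of the polarisation identity: the real part of the Hermitian product is the
  real inner product of \<open>\<complex>\<^sup>n\<close>, and \<open>|\<xi>|\<^sup>2 = |\<xi> - \<eta>|\<^sup>2 + 2 (\<xi> - \<eta>) \<bullet> \<eta> + |\<eta>|\<^sup>2\<close>.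
\<close>

lemma C2_eq_norm_power2: "C2 \<xi> \<eta> = (norm \<eta>)\<^sup>2"
proof -
  have "Re (\<Sum>i\<in>UNIV. (\<xi> - \<eta>) $ i * cnj (\<eta> $ i)) = (\<xi> - \<eta>) \<bullet> \<eta>"
    by (simp add: inner_vec_def inner_complex_def)
  then show ?thesis
    by (simp add: C2_def power2_norm_eq_inner inner_diff inner_commute)
qed

lemma linear_eq_sum_axis:
  assumes "linear (D :: real ^ 'n \<Rightarrow> 'b::real_vector)"
  shows "D v = (\<Sum>i\<in>UNIV. v $ i *\<^sub>R D (axis i 1))"
proof -
  have "D v = D (\<Sum>i\<in>UNIV. v $ i *\<^sub>R axis i 1)"
    by (simp add: basis_expansion[of v] flip: scalar_mult_eq_scaleR)
  also have "\<dots> = (\<Sum>i\<in>UNIV. v $ i *\<^sub>R D (axis i 1))"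
    by (simp add: linear_sum[OF assms] linear_scale[OF assms])
  finally show ?thesis .
qed

text \<open>
  The vector field \<open>z f(z)\<close> as an element of \<open>\<complex>\<^sup>n\<close>, so that the expansion of the square is a
  computation in the real inner product space \<open>\<complex>\<^sup>n\<close>.
\<close>

definition position_times :: "(real ^ 'n \<Rightarrow> complex) \<Rightarrow> real ^ 'n \<Rightarrow> complex ^ 'n" where
  "position_times f z = (\<chi> i. z $ i *\<^sub>R f z)"

lemma norm_position_times: "(norm (position_times f z))\<^sup>2 = (norm z)\<^sup>2 * (cmod (f z))\<^sup>2"
  unfolding power2_norm_eq_inner inner_vec_def
  by (simp add: position_times_def sum_distrib_left mult_ac)

text \<open>
  Contracting the partial derivatives with the coordinates of \<open>z\<close> turns the cross term of the
  expanded square into a radial derivative.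
\<close>

lemma inner_gradient_position_times:
  assumes "f differentiable (at z)"
  shows "gradient f z \<bullet> position_times f z = frechet_derivative f (at z) z \<bullet> f z"
proof -
  have "linear (frechet_derivative f (at z))"
    using assms frechet_derivative_works has_derivative_linear by blast
  from linear_eq_sum_axis[OF this, of z] show ?thesis
    by (simp add: inner_vec_def gradient_def position_times_def inner_sum_left)
qed

text \<open>
  Dividing by the Gaussian is multiplying by \<open>exp (a |w|\<^sup>2)\<close>, whose logarithmic gradient is \<open>2a w\<close>;
  the factor \<open>gaussian\<close> in front of the gradient cancels the exponential.
\<close>

lemma weighted_gradient_eq:
  assumes "f differentiable (at z)"
  shows "weighted_gradient a f z = gradient f z + (2 * a) *\<^sub>R position_times f z"
proof -
  let ?D = "frechet_derivative f (at z)"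
  have D: "(f has_derivative ?D) (at z)"
    using assms frechet_derivative_works by blast
  have quotient: "(\<lambda>w. f w / complex_of_real (gaussian a w)) = (\<lambda>w. exp (a * (w \<bullet> w)) *\<^sub>R f w)"
    by (simp add: fun_eq_iff gaussian_def power2_norm_eq_inner exp_minus scaleR_conv_of_real field_simps
        flip: of_real_inverse)
  have "((\<lambda>w. exp (a * (w \<bullet> w)) *\<^sub>R f w) has_derivative
      (\<lambda>v. exp (a * (z \<bullet> z)) *\<^sub>R ?D v + (exp (a * (z \<bullet> z)) * (2 * a * (z \<bullet> v))) *\<^sub>R f z)) (at z)"
    by (rule derivative_eq_intros D refl | simp add: inner_commute algebra_simps)+
  from frechet_derivative_at[OF this, symmetric]
  have "gradient (\<lambda>w. f w / complex_of_real (gaussian a w)) z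
      = exp (a * (z \<bullet> z)) *\<^sub>R (gradient f z + (2 * a) *\<^sub>R position_times f z)"
    unfolding quotient
    by (simp add: vec_eq_iff gradient_def position_times_def inner_axis algebra_simps)
  then show ?thesis
    by (simp add: weighted_gradient_def gaussian_def power2_norm_eq_inner flip: exp_add)
qed

section \<open>The uncertainty identity\<close>

text \<open>
  If the integral vanished, \<open>f\<close> would be zero almost everywhere off the origin, so the open set
  \<open>f \<noteq> 0\<close> would be null and therefore empty.
\<close>

lemma weighted_L2_norm_nonzero:
  fixes f :: "'a::euclidean_space \<Rightarrow> complex"
  assumes cont: "continuous_on UNIV f" and out: "\<And>z. norm z > R \<Longrightarrow> f z = 0"
    and nonzero: "f \<noteq> (\<lambda>z. 0)"
  shows "(LINT z|lborel. (norm z)\<^sup>2 * (cmod (f z))\<^sup>2) \<noteq> 0"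
proof
  assume zero: "(LINT z|lborel. (norm z)\<^sup>2 * (cmod (f z))\<^sup>2) = 0"
  have "integrable lborel (\<lambda>z. (norm z)\<^sup>2 * (cmod (f z))\<^sup>2)"
    by (rule integrable_continuous_vanishing_outside_ball[where R = R])
       (auto intro!: continuous_intros cont simp: out)
  then have "AE z in lborel. (norm z)\<^sup>2 * (cmod (f z))\<^sup>2 = 0"
    using zero by (subst integral_nonneg_eq_0_iff_AE[symmetric]) auto
  moreover have "AE z in lborel. z \<noteq> (0::'a)"
    by (rule AE_lborel_singleton)
  ultimately have "AE z in lborel. z \<notin> {z. f z \<noteq> 0}"
    by eventually_elim auto
  moreover have op: "open {z. f z \<noteq> 0}"
    by (intro open_Collect_neq cont continuous_intros)
  ultimately have "{z. f z \<noteq> 0} \<in> null_sets lborel"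
    by (subst AE_iff_null_sets) auto
  then have "negligible {z. f z \<noteq> 0}"
    by (simp add: negligible_iff_null_sets null_sets_completionI)
  with op nonzero show False
    using open_not_negligible by (force simp: fun_eq_iff)
qed

lemma C0_infinityD:
  assumes "f \<in> C0_infinity"
  shows "f differentiable (at z)" and "continuous_on UNIV f" and "continuous_on UNIV (gradient f)"
    and "\<exists>R. \<forall>z. norm z > R \<longrightarrow> f z = 0"
proof -
  have "C_k (Suc 0) f" and K: "compact (closure (support_on UNIV f))"
    using assms by (auto simp: C0_infinity_def simp del: C_k.simps)
  then have diff: "f differentiable_on UNIV" and "\<And>i. continuous_on UNIV (\<lambda>z. gradient f z $ i)"
    by auto
  then show "continuous_on UNIV (gradient f)" "continuous_on UNIV f"
    by (auto simp: continuous_on_vec_lambda differentiable_imp_continuous_on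
        intro: continuous_on_vec_lambda[of UNIV "\<lambda>i z. gradient f z $ i", simplified])
  show "f differentiable (at z)"
    using diff by (simp add: differentiable_on_def)
  obtain R where "\<And>z. z \<in> closure (support_on UNIV f) \<Longrightarrow> norm z \<le> R"
    using compact_imp_bounded[OF K] by (auto simp: bounded_iff)
  then have "norm z \<le> R" if "f z \<noteq> 0" for z
    using that closure_subset[of "support_on UNIV f"] by (auto simp: support_on_def)
  then show "\<exists>R. \<forall>z. norm z > R \<longrightarrow> f z = 0"
    by (meson not_le)
qed

text \<open>
  The cross term of the expanded square is integrated exactly by \<open>integral_radial_derivative\<close>, so
  the energy of the weighted gradient is a quadratic polynomial in the Gaussian parameter.
\<close>

lemma integral_weighted_gradient:
  fixes f :: "real ^ 'n \<Rightarrow> complex"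
  assumes f: "f \<in> C0_infinity"
  shows "(LINT z|lborel. (norm (weighted_gradient a f z))\<^sup>2)
       = (LINT z|lborel. (norm (gradient f z))\<^sup>2)
         - 2 * a * real CARD('n) * (LINT z|lborel. (cmod (f z))\<^sup>2)
         + 4 * a\<^sup>2 * (LINT z|lborel. (norm z)\<^sup>2 * (cmod (f z))\<^sup>2)"
proof -
  note diff = C0_infinityD(1)[OF f] and cont = C0_infinityD(2,3)[OF f]
  obtain R where out: "\<And>z. norm z > R \<Longrightarrow> f z = 0"
    using C0_infinityD(4)[OF f] by auto
  let ?X = "position_times f"
  have cont_X: "continuous_on UNIV ?X"
    unfolding position_times_def[abs_def] by (intro continuous_intros cont)
  have D: "(f has_derivative frechet_derivative f (at z)) (at z)" for z
    using diff frechet_derivative_works by blast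
  have grad_out: "gradient f z = 0" if "norm z > R" for z
    using derivative_vanishes_outside_ball[OF D out that] by (simp add: gradient_def vec_eq_iff)
  have X_out: "?X z = 0" if "norm z > R" for z
    using out[OF that] by (simp add: position_times_def vec_eq_iff)
  have "(LINT z|lborel. gradient f z \<bullet> ?X z) = - (real CARD('n) / 2 * (LINT z|lborel. (cmod (f z))\<^sup>2))"
  proof -
    \<comment> \<open>Twice the cross term is the radial derivative of \<open>|f|\<^sup>2\<close>.\<close>
    have "((\<lambda>z. (cmod (f z))\<^sup>2) has_derivative
        (\<lambda>v. 2 * (frechet_derivative f (at z) v \<bullet> f z))) (at z)" for z
      unfolding power2_norm_eq_inner
      by (rule derivative_eq_intros D refl | simp add: inner_commute)+
    moreover have "continuous_on UNIV (\<lambda>z. 2 * (frechet_derivative f (at z) z \<bullet> f z))"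
      unfolding inner_gradient_position_times[OF diff, symmetric]
      by (intro continuous_intros cont cont_X)
    ultimately have "(LINT z|lborel. 2 * (frechet_derivative f (at z) z \<bullet> f z))
        = - real DIM(real ^ 'n) * (LINT z|lborel. (cmod (f z))\<^sup>2)"
      by (rule integral_radial_derivative[where R = R]) (simp add: out)
    then show ?thesis
      by (simp add: inner_gradient_position_times[OF diff])
  qed
  moreover have "integrable lborel (\<lambda>z. (norm (gradient f z))\<^sup>2)"
      "integrable lborel (\<lambda>z. gradient f z \<bullet> ?X z)"
      "integrable lborel (\<lambda>z. (norm (?X z))\<^sup>2)"
    by (rule integrable_continuous_vanishing_outside_ball[where R = R],
        auto intro!: continuous_intros cont cont_X simp: grad_out X_out)+
  moreover have "(norm (weighted_gradient a f z))\<^sup>2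
      = (norm (gradient f z))\<^sup>2 + 4 * a * (gradient f z \<bullet> ?X z) + 4 * a\<^sup>2 * (norm (?X z))\<^sup>2" for z
    unfolding weighted_gradient_eq[OF diff] power2_norm_eq_inner
    by (simp add: inner_add inner_commute power2_eq_square algebra_simps)
  ultimately show ?thesis
    by (simp add: norm_position_times algebra_simps)
qed

theorem corollary3p18:
  fixes f :: "real ^ 'n \<Rightarrow> complex"
  assumes "f \<in> C0_infinity" and "f \<noteq> (\<lambda>z. 0)"
  shows "(LINT z|lborel. (norm (gradient f z))\<^sup>2) * (LINT z|lborel. (norm z)\<^sup>2 * (cmod (f z))\<^sup>2)
           - (real CARD('n))\<^sup>2 / 4 * (LINT z|lborel. (cmod (f z))\<^sup>2)\<^sup>2
         = (LINT z|lborel. (norm z)\<^sup>2 * (cmod (f z))\<^sup>2)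
           * (LINT z|lborel. C2 (gradient f z) (weighted_gradient (alpha2 f) f z))
       \<and> (LINT z|lborel. (norm z)\<^sup>2 * (cmod (f z))\<^sup>2)
           * (LINT z|lborel. C2 (gradient f z) (weighted_gradient (alpha2 f) f z))
         = (LINT z|lborel. (norm z)\<^sup>2 * (cmod (f z))\<^sup>2)
           * (LINT z|lborel. (norm (weighted_gradient (alpha2 f) f z))\<^sup>2)"
proof -
  let ?B = "LINT z|lborel. (norm z)\<^sup>2 * (cmod (f z))\<^sup>2"
  \<comment> \<open>Without this, \<open>alpha2 f\<close> would be the default value of a division by zero.\<close>
  have B: "?B \<noteq> 0"
    using C0_infinityD(2,4)[OF assms(1)] assms(2) weighted_L2_norm_nonzero by blast
  show ?thesis
    unfolding C2_eq_norm_power2 integral_weighted_gradient[OF assms(1)] alpha2_def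
    using B by (simp add: field_simps power2_eq_square)
qed

end
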